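(* There is an algorithm (COMMA) that solves the continuous map matching problem on paths (defined in the context) on inputs for which the disks $D_1,\dots,D_k$ are pairwise non-overlapping (disjoint) in time $\mathcal{O}(k\, n \log n)$, where $n$ is the number of nodes of the path and $k$ is the number of measurements. That is, within this time the algorithm outputs a feasible mapping sequence if one exists, and otherwise reports that none exists.
   Context: Continuous map matching on paths. Input: (1) a directed path $P = v_1,\dots,v_n$ ($n\ge 2$) whose nodes have coordinates in $\mathbb{R}^2$, whose edges are embedded as straight line segments and carry positive travel time costs, interpolated linearly along each edge; (2) a sequence of $k \ge 2$ measurements $M_i=(p_i,t_i)$, $i=1,\dots,k$, with position $p_i\in\mathbb{R}^2$ and timestamp $t_i\in\mathbb{R}$; (3) a radius $r\in\mathbb{R}_{\ge 0}$. Let $T$ be the total travel time of $P$ and let $\gamma:[0,T]\to\mathbb{R}^2$ be the piecewise linear parametrization of $P$ by travel time from its start. A location on $P$ is identified with its parameter in $[0,T]$. For locations $l\le l'$ the travel time is $t(l,l')=l'-l$; if $l>l'$ then $l'$ cannot be reached from $l$ (the path is directed). A feasible mapping sequence is a sequence of locations $l_1,\dots,l_k\in[0,T]$ with $\|\gamma(l_i)-p_i\|\le r$ for all $i=1,\dots,k$ (that is, $l_i$ lies in the closed disk $D_i$ of radius $r$ centered at $p_i$), and $l_{i-1}\le l_i$ and $t(l_{i-1},l_i)\le t_i-t_{i-1}$ for all $i=2,\dots,k$. Running times are in the real RAM model (unit-cost exact arithmetic and comparisons on reals, including square roots). *)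

theory Defs
  imports "HOL-Analysis.Analysis"
begin

section \<open>Continuous map matching on paths\<close>

text \<open>Nodes and measurements are 0-indexed lists; \<open>costs ! j\<close> is the travel time of the edge
  from \<open>nodes ! j\<close> to \<open>nodes ! Suc j\<close>. The product norm on \<open>real \<times> real\<close> is the Euclidean one.\<close>

record instance_mm =
  nodes :: "(real \<times> real) list"
  costs :: "real list"
  measurements :: "((real \<times> real) \<times> real) list"
  radius :: real

definition num_nodes :: "instance_mm \<Rightarrow> nat" where
  "num_nodes I = length (nodes I)"

definition num_meas :: "instance_mm \<Rightarrow> nat" where
  "num_meas I = length (measurements I)"

definition position :: "instance_mm \<Rightarrow> nat \<Rightarrow> real \<times> real" where
  "position I i = fst (measurements I ! i)"

definition timestamp :: "instance_mm \<Rightarrow> nat \<Rightarrow> real" where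
  "timestamp I i = snd (measurements I ! i)"

definition valid_instance :: "instance_mm \<Rightarrow> bool" where
  "valid_instance I \<longleftrightarrow>
     num_nodes I \<ge> 2 \<and> length (costs I) + 1 = num_nodes I \<and> (\<forall>c \<in> set (costs I). c > 0) \<and>
     num_meas I \<ge> 2 \<and> radius I \<ge> 0"

definition total_time :: "instance_mm \<Rightarrow> real" where
  "total_time I = sum_list (costs I)"

text \<open>The second equation is only relevant for lists that do not describe a path with an edge.\<close>

fun curve :: "(real \<times> real) list \<Rightarrow> real list \<Rightarrow> real \<Rightarrow> real \<times> real" where
  "curve (v # w # vs) (c # cs) l =
     (if l \<le> c then linepath v w (l / c) else curve (w # vs) cs (l - c))"
| "curve vs cs l = hd vs"

definition \<gamma> :: "instance_mm \<Rightarrow> real \<Rightarrow> real \<times> real" where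
  "\<gamma> I = curve (nodes I) (costs I)"

definition disk :: "instance_mm \<Rightarrow> nat \<Rightarrow> (real \<times> real) set" where
  "disk I i = cball (position I i) (radius I)"

definition disjoint_disks :: "instance_mm \<Rightarrow> bool" where
  "disjoint_disks I \<longleftrightarrow> disjoint_family_on (disk I) {..<num_meas I}"

definition feasible :: "instance_mm \<Rightarrow> real list \<Rightarrow> bool" where
  "feasible I ls \<longleftrightarrow>
     length ls = num_meas I \<and>
     (\<forall>i < num_meas I. 0 \<le> ls ! i \<and> ls ! i \<le> total_time I \<and>
        norm (\<gamma> I (ls ! i) - position I i) \<le> radius I) \<and>
     (\<forall>i. 1 \<le> i \<and> i < num_meas I \<longrightarrow>
        ls ! (i - 1) \<le> ls ! i \<and>
        ls ! i - ls ! (i - 1) \<le> timestamp I i - timestamp I (i - 1))"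

text \<open>On every edge, \<open>\<gamma>\<close> is the linear interpolation by travel time.\<close>

lemma curve_edge:
  assumes "length vs = Suc (length cs)" "\<forall>c \<in> set cs. c > 0" "j < length cs"
    and "sum_list (take j cs) \<le> l" "l \<le> sum_list (take (Suc j) cs)"
  shows "curve vs cs l = linepath (vs ! j) (vs ! Suc j) ((l - sum_list (take j cs)) / cs ! j)"
  using assms
proof (induction vs cs l arbitrary: j rule: curve.induct)
  case (1 v w vs c cs l)
  show ?case
  proof (cases j)
    case 0
    then show ?thesis using 1 by simp
  next
    case (Suc j')
    have pos: "\<forall>x \<in> set cs. x > 0" and len: "length (w # vs) = Suc (length cs)" and c: "c > 0"
      and j': "j' < length cs" using 1 Suc by auto
    have nn: "sum_list (take i cs) \<ge> 0" for i
      by (rule sum_list_nonneg) (meson pos in_set_takeD less_imp_le)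
    have lo: "sum_list (take j' cs) \<le> l - c" and up: "l - c \<le> sum_list (take (Suc j') cs)"
      using 1 Suc by auto
    show ?thesis
    proof (cases "l \<le> c")
      case True
      then have l: "l = c" and z: "sum_list (take j' cs) = 0" using lo nn[of j'] by linarith+
      have "j' = 0"
      proof (rule ccontr)
        assume "j' \<noteq> 0"
        then obtain i where i: "j' = Suc i" by (cases j') auto
        have "sum_list (take j' cs) = sum_list (take i cs) + cs ! i"
          using i j' by (simp add: take_Suc_conv_app_nth)
        moreover have "cs ! i > 0" using pos i j' by simp
        ultimately show False using z nn[of i] by linarith
      qed
      then show ?thesis using Suc l c by (simp add: linepath_def)
    next
      case False
      then show ?thesis
        using "1.IH"[OF False len pos j' lo up] Suc by (simp add: algebra_simps)
    qed
  qed
qed auto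


section \<open>Real RAM\<close>

text \<open>A real RAM has an unbounded memory of natural numbers, used for counters and addresses,
  and an unbounded memory of exact reals, both with indirect addressing. Programs are finite
  syntax trees. Every elementary operation has unit cost: constants, memory accesses, arithmetic
  operations, comparisons, Boolean operations, assignments and jumps. The only operations on
  indices are addition and truncated subtraction, there are no conversions between indices and
  reals, and the only real constants are integers. Following HOL, dividing by zero yields 0 and
  the root of a negative number is the negated root of its absolute value; since programs can
  test operands, this affects running times by a constant factor only.\<close>

datatype iexp =
    IConst nat
  | ICell iexp
  | IPlus iexp iexp
  | IMinus iexp iexp

datatype rexp =
    RConst int
  | RCell iexp
  | RPlus rexp rexp
  | RMinus rexp rexp
  | RTimes rexp rexp
  | RDivide rexp rexp
  | RSqrt rexp

datatype bexp =
    ILess iexp iexp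
  | RLess rexp rexp
  | BNot bexp
  | BAnd bexp bexp

text \<open>The destination of an assignment is a computed address.\<close>

datatype com =
    Skip
  | IAssign iexp iexp
  | RAssign iexp rexp
  | Seq com com
  | Cond bexp com com
  | Loop bexp com

record store =
  imem :: "nat \<Rightarrow> nat"
  rmem :: "nat \<Rightarrow> real"

fun ival :: "iexp \<Rightarrow> store \<Rightarrow> nat" where
  "ival (IConst c) s = c"
| "ival (ICell a) s = imem s (ival a s)"
| "ival (IPlus a b) s = ival a s + ival b s"
| "ival (IMinus a b) s = ival a s - ival b s"

fun rval :: "rexp \<Rightarrow> store \<Rightarrow> real" where
  "rval (RConst c) s = of_int c"
| "rval (RCell a) s = rmem s (ival a s)"
| "rval (RPlus e f) s = rval e s + rval f s"
| "rval (RMinus e f) s = rval e s - rval f s"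
| "rval (RTimes e f) s = rval e s * rval f s"
| "rval (RDivide e f) s = rval e s / rval f s"
| "rval (RSqrt e) s = sqrt (rval e s)"

fun bval :: "bexp \<Rightarrow> store \<Rightarrow> bool" where
  "bval (ILess a b) s \<longleftrightarrow> ival a s < ival b s"
| "bval (RLess e f) s \<longleftrightarrow> rval e s < rval f s"
| "bval (BNot b) s \<longleftrightarrow> \<not> bval b s"
| "bval (BAnd b c) s \<longleftrightarrow> bval b s \<and> bval c s"

fun icost :: "iexp \<Rightarrow> nat" where
  "icost (IConst c) = 1"
| "icost (ICell a) = 1 + icost a"
| "icost (IPlus a b) = 1 + icost a + icost b"
| "icost (IMinus a b) = 1 + icost a + icost b"

fun rcost :: "rexp \<Rightarrow> nat" where
  "rcost (RConst c) = 1"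
| "rcost (RCell a) = 1 + icost a"
| "rcost (RPlus e f) = 1 + rcost e + rcost f"
| "rcost (RMinus e f) = 1 + rcost e + rcost f"
| "rcost (RTimes e f) = 1 + rcost e + rcost f"
| "rcost (RDivide e f) = 1 + rcost e + rcost f"
| "rcost (RSqrt e) = 1 + rcost e"

fun bcost :: "bexp \<Rightarrow> nat" where
  "bcost (ILess a b) = 1 + icost a + icost b"
| "bcost (RLess e f) = 1 + rcost e + rcost f"
| "bcost (BNot b) = 1 + bcost b"
| "bcost (BAnd b c) = 1 + bcost b + bcost c"

text \<open>\<open>exec c s t s'\<close>: started in \<open>s\<close>, program \<open>c\<close> halts in \<open>s'\<close> after \<open>t\<close> time units.\<close>

inductive exec :: "com \<Rightarrow> store \<Rightarrow> nat \<Rightarrow> store \<Rightarrow> bool" where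
  Skip: "exec Skip s 1 s"
| IAssign: "exec (IAssign a e) s (1 + icost a + icost e)
    (s\<lparr>imem := (imem s)(ival a s := ival e s)\<rparr>)"
| RAssign: "exec (RAssign a e) s (1 + icost a + rcost e)
    (s\<lparr>rmem := (rmem s)(ival a s := rval e s)\<rparr>)"
| Seq: "exec c s t s' \<Longrightarrow> exec d s' u s'' \<Longrightarrow> exec (Seq c d) s (t + u) s''"
| CondTrue: "bval b s \<Longrightarrow> exec c s t s' \<Longrightarrow> exec (Cond b c d) s (1 + bcost b + t) s'"
| CondFalse: "\<not> bval b s \<Longrightarrow> exec d s t s' \<Longrightarrow> exec (Cond b c d) s (1 + bcost b + t) s'"
| LoopFalse: "\<not> bval b s \<Longrightarrow> exec (Loop b c) s (1 + bcost b) s"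
| LoopTrue: "bval b s \<Longrightarrow> exec c s t s' \<Longrightarrow> exec (Loop b c) s' u s'' \<Longrightarrow>
    exec (Loop b c) s (1 + bcost b + t + u) s''"

inductive_cases exec_SkipE: "exec Skip s t s'"
inductive_cases exec_IAssignE: "exec (IAssign a e) s t s'"
inductive_cases exec_RAssignE: "exec (RAssign a e) s t s'"
inductive_cases exec_SeqE: "exec (Seq c d) s t s'"
inductive_cases exec_CondE: "exec (Cond b c d) s t s'"
inductive_cases exec_LoopE: "exec (Loop b c) s t s'"

lemma exec_deterministic:
  "exec c s t s' \<Longrightarrow> exec c s u s'' \<Longrightarrow> u = t \<and> s'' = s'"
proof (induction arbitrary: u s'' rule: exec.induct)
  case (Seq c s t s' d v r)
  from Seq.prems obtain t1 u1 m where "exec c s t1 m" "exec d m u1 s''" "u = t1 + u1"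
    by (rule exec_SeqE)
  then show ?case using Seq.IH by metis
next
  case (CondTrue b s c t s' d)
  from CondTrue.prems obtain t1 where "exec c s t1 s''" "u = 1 + bcost b + t1"
    by (rule exec_CondE) (use CondTrue.hyps in auto)
  then show ?case using CondTrue.IH by metis
next
  case (CondFalse b s d t s' c)
  from CondFalse.prems obtain t1 where "exec d s t1 s''" "u = 1 + bcost b + t1"
    by (rule exec_CondE) (use CondFalse.hyps in auto)
  then show ?case using CondFalse.IH by metis
next
  case (LoopFalse b s c)
  from LoopFalse.prems show ?case
    by (rule exec_LoopE) (use LoopFalse.hyps in auto)
next
  case (LoopTrue b s c t s' v r)
  from LoopTrue.prems obtain t1 u1 m
    where "exec c s t1 m" "exec (Loop b c) m u1 s''" "u = 1 + bcost b + t1 + u1"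
    by (rule exec_LoopE) (use LoopTrue.hyps in auto)
  then show ?case using LoopTrue.IH by metis
qed (auto elim: exec_SkipE exec_IAssignE exec_RAssignE)


section \<open>Solving the problem on a real RAM\<close>

text \<open>Input: index cells 0 and 1 hold \<open>n\<close> and \<open>k\<close>; the real memory starts with the radius,
  followed by the node coordinates, the edge costs and the measurements. All other cells are 0.\<close>

definition encode :: "instance_mm \<Rightarrow> real list" where
  "encode I = radius I # concat (map (\<lambda>(x, y). [x, y]) (nodes I)) @ costs I @
     concat (map (\<lambda>((x, y), t). [x, y, t]) (measurements I))"

definition input_store :: "instance_mm \<Rightarrow> store" where
  "input_store I = \<lparr>
     imem = (\<lambda>_. 0)(0 := num_nodes I, 1 := num_meas I),
     rmem = (\<lambda>a. if a < length (encode I) then encode I ! a else 0)\<rparr>"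

text \<open>Output: index cell 0 holds 1 and the first \<open>k\<close> real cells hold a feasible mapping sequence,
  or index cell 0 holds 0 to report that there is none.\<close>

definition correct_output :: "instance_mm \<Rightarrow> store \<Rightarrow> bool" where
  "correct_output I s \<longleftrightarrow>
     (if \<exists>ls. feasible I ls
      then imem s 0 = 1 \<and> feasible I (map (rmem s) [0..<num_meas I])
      else imem s 0 = 0)"

end

theory Submission
  imports Defs
begin

text \<open>Sweep over the measurements. If a location \<open>l'\<close> in \<open>D\<^sub>i\<close> precedes a location \<open>l\<close> in
  \<open>D\<^sub>i\<^sub>+\<^sub>1\<close> on a common edge, then by convexity the parts of the edge inside the two disjoint disks are
  separated, so \<open>l\<close> is reachable iff the last reachable location of \<open>D\<^sub>i\<close> before the whole chord of
  \<open>l\<close> is recent enough. Hence the reachable part of each chord is a prefix, determined by its right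
  end. One pass along the path turns the table row of right ends for one measurement into the next,
  and the same separation shows that going back greedily to the last right end that does not lie
  ahead recovers a mapping sequence. This takes time \<open>O(k n)\<close>.\<close>

section \<open>Running programs\<close>

primrec loop_free :: "com \<Rightarrow> bool" where
  "loop_free Skip \<longleftrightarrow> True"
| "loop_free (IAssign a e) \<longleftrightarrow> True"
| "loop_free (RAssign a e) \<longleftrightarrow> True"
| "loop_free (Seq c d) \<longleftrightarrow> loop_free c \<and> loop_free d"
| "loop_free (Cond b c d) \<longleftrightarrow> loop_free c \<and> loop_free d"
| "loop_free (Loop b c) \<longleftrightarrow> False"

text \<open>The values at loops are junk.\<close>

primrec effect :: "com \<Rightarrow> store \<Rightarrow> store" where
  "effect Skip s = s"
| "effect (IAssign a e) s = s\<lparr>imem := (imem s)(ival a s := ival e s)\<rparr>"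
| "effect (RAssign a e) s = s\<lparr>rmem := (rmem s)(ival a s := rval e s)\<rparr>"
| "effect (Seq c d) s = effect d (effect c s)"
| "effect (Cond b c d) s = (if bval b s then effect c s else effect d s)"
| "effect (Loop b c) s = s"

primrec duration :: "com \<Rightarrow> nat" where
  "duration Skip = 1"
| "duration (IAssign a e) = 1 + icost a + icost e"
| "duration (RAssign a e) = 1 + icost a + rcost e"
| "duration (Seq c d) = duration c + duration d"
| "duration (Cond b c d) = 1 + bcost b + max (duration c) (duration d)"
| "duration (Loop b c) = 0"

lemma exec_loop_free:
  "loop_free c \<Longrightarrow> \<exists>t \<le> duration c. exec c s t (effect c s)"
proof (induction c arbitrary: s)
  case (Seq c d)
  then show ?case
    by simp (meson add_mono exec.Seq)
next
  case (Cond b c d)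
  obtain t u where "t \<le> duration c" "exec c s t (effect c s)"
    and "u \<le> duration d" "exec d s u (effect d s)"
    using Cond by fastforce
  then show ?case
    using exec.CondTrue[of b s c t "effect c s" d] exec.CondFalse[of b s d u "effect d s" c]
    by (intro exI[of _ "1 + bcost b + (if bval b s then t else u)"]) auto
next
  case Skip
  then show ?case using exec.Skip by fastforce
next
  case (IAssign a e)
  then show ?case using exec.IAssign[of a e s] by fastforce
next
  case (RAssign a e)
  then show ?case using exec.RAssign[of a e s] by fastforce
qed simp

text \<open>Total correctness with a time budget. Since \<open>exec\<close> is deterministic,
  exhibiting one halting run describes the only behaviour.\<close>

definition runs :: "com \<Rightarrow> store \<Rightarrow> nat \<Rightarrow> (store \<Rightarrow> bool) \<Rightarrow> bool" where
  "runs c s t Q \<longleftrightarrow> (\<exists>u s'. exec c s u s' \<and> u \<le> t \<and> Q s')"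

lemma runs_loop_free: "loop_free c \<Longrightarrow> Q (effect c s) \<Longrightarrow> runs c s (duration c) Q"
  unfolding runs_def using exec_loop_free by blast

lemma runs_Seq:
  "runs c s t P \<Longrightarrow> (\<And>s'. P s' \<Longrightarrow> runs d s' u Q) \<Longrightarrow> runs (Seq c d) s (t + u) Q"
  unfolding runs_def by (meson add_mono exec.Seq)

lemma runs_mono:
  "runs c s t P \<Longrightarrow> t \<le> u \<Longrightarrow> (\<And>s'. P s' \<Longrightarrow> Q s') \<Longrightarrow> runs c s u Q"
  unfolding runs_def by (meson order_trans)

text \<open>The invariant is indexed by the number of completed rounds, which fixes the iteration
  count at \<open>N\<close>. The factor \<open>Suc N\<close> also pays for the final failing
  test.\<close>

lemma runs_Loop:
  assumes step: "\<And>m s. m < N \<Longrightarrow> Inv m s \<Longrightarrow> bval b s \<and> runs c s t (Inv (Suc m))"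
    and exit: "\<And>s. Inv N s \<Longrightarrow> \<not> bval b s"
    and init: "Inv 0 s"
  shows "runs (Loop b c) s (Suc N * (1 + bcost b + t)) (Inv N)"
proof -
  have "Inv m s \<Longrightarrow> m \<le> N \<Longrightarrow> runs (Loop b c) s (Suc (N - m) * (1 + bcost b + t)) (Inv N)" for m s
  proof (induction "N - m" arbitrary: m s)
    case 0
    then have "m = N" by simp
    then have "exec (Loop b c) s (1 + bcost b) s" using 0 exit by (blast intro: exec.LoopFalse)
    then show ?case using 0 \<open>m = N\<close> unfolding runs_def by fastforce
  next
    case (Suc d)
    then have "m < N" by simp
    then obtain u s' where b: "bval b s" and u: "exec c s u s'" "u \<le> t" "Inv (Suc m) s'"
      using step[of m s] Suc.prems unfolding runs_def by auto
    obtain v s'' where v: "exec (Loop b c) s' v s''" "v \<le> Suc (N - Suc m) * (1 + bcost b + t)"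
      "Inv N s''"
      using Suc.hyps(1)[of "Suc m" s'] Suc.hyps(2) u(3) \<open>m < N\<close>
      unfolding runs_def by (metis Suc_diff_Suc Suc_leI nat.inject)
    have "N - m = Suc (N - Suc m)" using \<open>m < N\<close> by simp
    then have "1 + bcost b + u + v \<le> Suc (N - m) * (1 + bcost b + t)"
      using u(2) v(2) by simp
    then show ?case
      using exec.LoopTrue[OF b u(1) v(1)] v(3) unfolding runs_def by blast
  qed
  from this[of 0 s] init show ?thesis by simp
qed

definition assign_max :: "iexp \<Rightarrow> rexp \<Rightarrow> rexp \<Rightarrow> com" where
  "assign_max a e f = Cond (RLess e f) (RAssign a f) (RAssign a e)"

definition assign_min :: "iexp \<Rightarrow> rexp \<Rightarrow> rexp \<Rightarrow> com" where
  "assign_min a e f = Cond (RLess e f) (RAssign a e) (RAssign a f)"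

lemma loop_free_assign [simp]: "loop_free (assign_max a e f)" "loop_free (assign_min a e f)"
  by (simp_all add: assign_max_def assign_min_def)

lemma effect_assign_max [simp]:
  "effect (assign_max a e f) s = s\<lparr>rmem := (rmem s)(ival a s := max (rval e s) (rval f s))\<rparr>"
  by (simp add: assign_max_def max_def)

lemma effect_assign_min [simp]:
  "effect (assign_min a e f) s = s\<lparr>rmem := (rmem s)(ival a s := min (rval e s) (rval f s))\<rparr>"
  by (simp add: assign_min_def min_def)


section \<open>The solution set of a quadratic inequality in the unit interval\<close>

text \<open>For \<open>0 < a\<close> and a nonnegative discriminant, this is the smaller root of
  \<open>a x^2 + 2 b x + g\<close>, and \<open>chord_hi\<close> is the larger one. Each is clipped
  on its own side only, so a root interval that misses the unit interval ends up with its ends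
  reversed, which encodes the empty set; so does the pair \<open>0\<close>,
  \<open>-1\<close>.\<close>

definition chord_lo :: "real \<Rightarrow> real \<Rightarrow> real \<Rightarrow> real" where
  "chord_lo a b g =
     (if 0 < a \<and> 0 \<le> b * b - a * g then max ((- b - sqrt (b * b - a * g)) / a) 0 else 0)"

definition chord_hi :: "real \<Rightarrow> real \<Rightarrow> real \<Rightarrow> real" where
  "chord_hi a b g =
     (if 0 < a \<and> 0 \<le> b * b - a * g then min ((- b + sqrt (b * b - a * g)) / a) 1
      else if \<not> 0 < a \<and> \<not> 0 < g then 1 else - 1)"

text \<open>Multiplying by \<open>a > 0\<close> and completing the square gives
  \<open>(a x + b)^2 <= b^2 - a g\<close>. The case \<open>a = 0\<close> belongs to an edge with
  coinciding end points, where the expression is the constant \<open>g\<close>.\<close>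

lemma chord:
  assumes "0 \<le> a" "a = 0 \<Longrightarrow> b = 0" "0 \<le> x" "x \<le> 1"
  shows "a * x\<^sup>2 + 2 * b * x + g \<le> 0 \<longleftrightarrow> chord_lo a b g \<le> x \<and> x \<le> chord_hi a b g"
proof (cases "0 < a")
  case True
  have "a * x\<^sup>2 + 2 * b * x + g \<le> 0 \<longleftrightarrow> a * (a * x\<^sup>2 + 2 * b * x + g) \<le> 0"
    using True by (simp add: mult_le_0_iff)
  also have "\<dots> \<longleftrightarrow> (a * x + b)\<^sup>2 \<le> b * b - a * g"
    by (simp add: power2_eq_square algebra_simps)
  finally have quad: "a * x\<^sup>2 + 2 * b * x + g \<le> 0 \<longleftrightarrow> (a * x + b)\<^sup>2 \<le> b * b - a * g" .
  show ?thesis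
  proof (cases "0 \<le> b * b - a * g")
    case D: True
    have "(a * x + b)\<^sup>2 \<le> b * b - a * g \<longleftrightarrow> \<bar>a * x + b\<bar> \<le> sqrt (b * b - a * g)"
      using D real_sqrt_le_iff[of "(a * x + b)\<^sup>2" "b * b - a * g"] by simp
    also have "\<dots> \<longleftrightarrow> - b - sqrt (b * b - a * g) \<le> x * a \<and> x * a \<le> - b + sqrt (b * b - a * g)"
      by (auto simp: abs_le_iff algebra_simps)
    also have "\<dots> \<longleftrightarrow> chord_lo a b g \<le> x \<and> x \<le> chord_hi a b g"
      using True D assms by (simp add: chord_lo_def chord_hi_def divide_le_eq le_divide_eq)
    finally show ?thesis using quad by simp
  next
    case False
    then have "\<not> (a * x + b)\<^sup>2 \<le> b * b - a * g"
      using zero_le_power2[of "a * x + b"] by linarith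
    then show ?thesis using quad False True assms by (simp add: chord_hi_def)
  qed
next
  case False
  then show ?thesis using assms by (simp add: chord_lo_def chord_hi_def)
qed

lemma chord_lo_nonneg: "0 \<le> chord_lo a b g"
  by (simp add: chord_lo_def)

lemma chord_hi_le_1: "chord_hi a b g \<le> 1"
  by (simp add: chord_hi_def)


section \<open>The largest value below a bound\<close>

text \<open>The default \<open>-1\<close> lies below every location, so a negative value signals
  that nothing qualified.\<close>

definition peak :: "real set \<Rightarrow> (nat \<Rightarrow> real) \<Rightarrow> nat \<Rightarrow> real" where
  "peak A f m = Max (insert (- 1) (f ` {..<m} \<inter> A))"

lemma peak_0 [simp]: "peak A f 0 = - 1"
  by (simp add: peak_def)

lemma peak_Suc: "peak A f (Suc m) = (if f m \<in> A then max (peak A f m) (f m) else peak A f m)"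
  by (auto simp: peak_def lessThan_Suc Int_insert_left max.left_commute max.commute
      insert_commute[of "- 1"])

lemma peak_ge: "j < m \<Longrightarrow> f j \<in> A \<Longrightarrow> f j \<le> peak A f m"
  by (auto simp: peak_def intro!: Max_ge)

lemma peak_cases:
  obtains "peak A f m = - 1" | j where "j < m" "f j \<in> A" "peak A f m = f j"
proof -
  have "peak A f m \<in> insert (- 1) (f ` {..<m} \<inter> A)"
    unfolding peak_def by (intro Max_in) auto
  then show ?thesis using that by auto
qed

lemma peak_cong: "(\<And>j. j < m \<Longrightarrow> f j \<in> A \<longleftrightarrow> f j \<in> A') \<Longrightarrow> peak A f m = peak A' f m"
  unfolding peak_def by (rule arg_cong[where f = "\<lambda>X. Max (insert (- 1) X)"]) auto


section \<open>Reachable locations\<close>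

locale matching =
  fixes I :: instance_mm
  assumes valid: "valid_instance I" and disjoint: "disjoint_disks I"
begin

abbreviation n :: nat where "n \<equiv> num_nodes I"
abbreviation k :: nat where "k \<equiv> num_meas I"
abbreviation edges :: nat where "edges \<equiv> length (costs I)"

lemma n_eq: "n = Suc edges" and edges_pos: "0 < edges" and k_pos: "0 < k"
  and radius_nonneg: "0 \<le> radius I"
  using valid by (auto simp: valid_instance_def)

section \<open>Travel times to the nodes\<close>

definition start :: "nat \<Rightarrow> real" where
  "start j = sum_list (take j (costs I))"

lemma start_0 [simp]: "start 0 = 0"
  by (simp add: start_def)

lemma start_Suc: "j < edges \<Longrightarrow> start (Suc j) = start j + costs I ! j"
  by (simp add: start_def take_Suc_conv_app_nth)

lemma start_edges: "start edges = total_time I"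
  by (simp add: start_def total_time_def)

lemma cost_pos: "j < edges \<Longrightarrow> 0 < costs I ! j"
  using valid by (simp add: valid_instance_def)

lemma start_mono: "i \<le> j \<Longrightarrow> j \<le> edges \<Longrightarrow> start i \<le> start j"
proof (induction j rule: dec_induct)
  case (step j)
  then show ?case using start_Suc[of j] cost_pos[of j] by simp
qed simp

lemma start_nonneg: "j \<le> edges \<Longrightarrow> 0 \<le> start j"
  using start_mono[of 0 j] by simp

lemma edge_exists:
  assumes "0 \<le> l" "l \<le> total_time I"
  obtains j where "j < edges" "start j \<le> l" "l \<le> start (Suc j)"
proof -
  define m where "m = (LEAST m. l \<le> start (Suc m))"
  have last: "l \<le> start (Suc (edges - 1))"
    using assms edges_pos by (simp add: start_edges)
  have "m \<le> edges - 1"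
    unfolding m_def by (rule Least_le) (rule last)
  then have "m < edges" using edges_pos by linarith
  moreover have "l \<le> start (Suc m)"
    unfolding m_def by (rule LeastI) (rule last)
  moreover have "start m \<le> l"
  proof (cases m)
    case (Suc m')
    then have "\<not> l \<le> start (Suc m')"
      unfolding m_def by (intro not_less_Least) simp
    then show ?thesis using Suc by simp
  qed (use assms in simp)
  ultimately show ?thesis using that by blast
qed

definition locations :: "nat \<Rightarrow> real set" where
  "locations i = {l. 0 \<le> l \<and> l \<le> total_time I \<and> norm (\<gamma> I l - position I i) \<le> radius I}"

text \<open>Disjointness of the disks enters here. The later separation arguments all end in a
  location that would lie in two disks.\<close>

lemma locations_disjoint:
  assumes "l \<in> locations i" "l \<in> locations i'" "i < k" "i' < k"
  shows "i = i'"
proof (rule ccontr)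
  assume "i \<noteq> i'"
  then have "disk I i \<inter> disk I i' = {}"
    using disjoint assms by (auto simp: disjoint_disks_def disjoint_family_on_def)
  moreover have "\<gamma> I l \<in> disk I i \<inter> disk I i'"
    using assms by (auto simp: locations_def disk_def dist_norm norm_minus_commute)
  ultimately show False by blast
qed

section \<open>Chords of the disks on the edges\<close>

definition dx :: "nat \<Rightarrow> real" where "dx j = fst (nodes I ! Suc j) - fst (nodes I ! j)"
definition dy :: "nat \<Rightarrow> real" where "dy j = snd (nodes I ! Suc j) - snd (nodes I ! j)"
definition qx :: "nat \<Rightarrow> nat \<Rightarrow> real" where "qx i j = fst (nodes I ! j) - fst (position I i)"
definition qy :: "nat \<Rightarrow> nat \<Rightarrow> real" where "qy i j = snd (nodes I ! j) - snd (position I i)"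

text \<open>The squared distance of the point at fraction \<open>x\<close> of edge \<open>j\<close> to measurement \<open>i\<close>,
  minus the squared radius, is \<open>a x\<^sup>2 + 2 b x + g\<close>.\<close>

definition coeff_a :: "nat \<Rightarrow> real" where
  "coeff_a j = dx j * dx j + dy j * dy j"
definition coeff_b :: "nat \<Rightarrow> nat \<Rightarrow> real" where
  "coeff_b i j = qx i j * dx j + qy i j * dy j"
definition coeff_g :: "nat \<Rightarrow> nat \<Rightarrow> real" where
  "coeff_g i j = qx i j * qx i j + qy i j * qy i j - radius I * radius I"

definition lo :: "nat \<Rightarrow> nat \<Rightarrow> real" where
  "lo i j = start j + costs I ! j * chord_lo (coeff_a j) (coeff_b i j) (coeff_g i j)"
definition hi :: "nat \<Rightarrow> nat \<Rightarrow> real" where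
  "hi i j = start j + costs I ! j * chord_hi (coeff_a j) (coeff_b i j) (coeff_g i j)"

lemma lo_ge: "j < edges \<Longrightarrow> start j \<le> lo i j"
  using cost_pos[of j] chord_lo_nonneg by (simp add: lo_def)

lemma hi_le: "j < edges \<Longrightarrow> hi i j \<le> start (Suc j)"
  using cost_pos[of j] chord_hi_le_1 by (simp add: hi_def start_Suc mult_le_cancel_left1)

lemma norm_linepath_le_iff:
  "norm (linepath (nodes I ! j) (nodes I ! Suc j) x - position I i) \<le> radius I \<longleftrightarrow>
     coeff_a j * x\<^sup>2 + 2 * coeff_b i j * x + coeff_g i j \<le> 0"
proof -
  let ?z = "linepath (nodes I ! j) (nodes I ! Suc j) x - position I i"
  have "norm ?z \<le> radius I \<longleftrightarrow> (norm ?z)\<^sup>2 \<le> (radius I)\<^sup>2"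
    using radius_nonneg by (simp add: abs_le_square_iff[symmetric])
  also have "(norm ?z)\<^sup>2 = (fst ?z)\<^sup>2 + (snd ?z)\<^sup>2"
    by (simp add: norm_prod_def)
  also have "\<dots> = coeff_a j * x\<^sup>2 + 2 * coeff_b i j * x + coeff_g i j + (radius I)\<^sup>2"
    by (simp add: linepath_def coeff_a_def coeff_b_def coeff_g_def dx_def dy_def qx_def qy_def
        power2_eq_square algebra_simps)
  finally show ?thesis by simp
qed

lemma locations_edge:
  assumes "j < edges" "start j \<le> l" "l \<le> start (Suc j)"
  shows "l \<in> locations i \<longleftrightarrow> lo i j \<le> l \<and> l \<le> hi i j"
proof -
  define x where "x = (l - start j) / costs I ! j"
  have c: "0 < costs I ! j" using assms cost_pos by simp
  then have l: "l = start j + costs I ! j * x" by (simp add: x_def)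
  have x: "0 \<le> x" "x \<le> 1"
    using assms c by (simp_all add: x_def start_Suc)
  have "0 \<le> l" "l \<le> total_time I"
    using assms start_nonneg[of j] start_mono[of "Suc j" edges] start_edges by simp_all
  moreover have "\<gamma> I l = linepath (nodes I ! j) (nodes I ! Suc j) x"
    unfolding \<gamma>_def x_def start_def using assms valid
    by (intro curve_edge) (auto simp: valid_instance_def num_nodes_def start_def)
  ultimately have "l \<in> locations i \<longleftrightarrow>
      coeff_a j * x\<^sup>2 + 2 * coeff_b i j * x + coeff_g i j \<le> 0"
    by (simp add: locations_def norm_linepath_le_iff)
  \<comment> \<open>The leading coefficient is a sum of two squares, so it vanishes only if
    \<open>dx j\<close> and \<open>dy j\<close> do, and then the linear one vanishes too.\<close>
  also have "\<dots> \<longleftrightarrow> chord_lo (coeff_a j) (coeff_b i j) (coeff_g i j) \<le> x \<and>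
      x \<le> chord_hi (coeff_a j) (coeff_b i j) (coeff_g i j)"
    using x by (intro chord) (auto simp: coeff_a_def coeff_b_def sum_squares_eq_zero_iff)
  also have "\<dots> \<longleftrightarrow> lo i j \<le> l \<and> l \<le> hi i j"
    using c by (simp add: lo_def hi_def l)
  finally show ?thesis .
qed

section \<open>Reachability along the path\<close>

definition gap :: "nat \<Rightarrow> real" where
  "gap i = timestamp I (Suc i) - timestamp I i"

text \<open>The possible last locations of mappings of the measurements \<open>0\<close> to
  \<open>i\<close> that satisfy all constraints so far.\<close>

primrec reachable :: "nat \<Rightarrow> real set" where
  "reachable 0 = locations 0"
| "reachable (Suc i) =
     {l \<in> locations (Suc i). \<exists>l' \<in> reachable i. l' \<le> l \<and> l - l' \<le> gap i}"

lemma reachable_locations: "reachable i \<subseteq> locations i"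
  by (cases i) auto

text \<open>On edge \<open>j\<close>, the locations reachable at measurement \<open>i\<close> are those from \<open>lo i j\<close> to
  \<open>furthest i j\<close>, where \<open>-1\<close> means that there are none.\<close>

primrec furthest :: "nat \<Rightarrow> nat \<Rightarrow> real" where
  "furthest 0 j = (if hi 0 j < lo 0 j then - 1 else hi 0 j)"
| "furthest (Suc i) j =
     (let m = peak {..lo (Suc i) j} (furthest i) (Suc j);
          h = (if m < 0 then - 1 else min (hi (Suc i) j) (m + gap i))
      in if h < lo (Suc i) j then - 1 else h)"

lemma furthest_cases:
  assumes "j < edges"
  obtains "furthest i j = - 1" | "lo i j \<le> furthest i j" "furthest i j \<le> hi i j"
proof -
  \<comment> \<open>Hence an intermediate value \<open>-1\<close> falls below \<open>lo i j\<close>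
    and is kept as the marker for an empty part.\<close>
  have "0 \<le> lo i j" using assms lo_ge[of j i] start_nonneg[of j] by simp
  then have "furthest i j = - 1 \<or> lo i j \<le> furthest i j \<and> furthest i j \<le> hi i j"
    by (cases i) (auto simp: Let_def)
  then show ?thesis using that by blast
qed

lemma furthest_le: "j < edges \<Longrightarrow> furthest i j \<le> start (Suc j)"
  using start_nonneg[of "Suc j"] hi_le[of j i] by (auto elim: furthest_cases[of j i])

text \<open>The edge is straight, so its part inside a disk is an interval. The marker
  \<open>-1\<close> cannot be the right end here, because \<open>l\<close> is at least
  \<open>l' >= 0\<close>.\<close>

lemma locations_between:
  assumes "j < edges" "start j \<le> l'" "l' \<in> locations i" "l' \<le> l" "l \<le> furthest i j"
  shows "l \<in> locations i"
proof -
  have "0 \<le> l'" using assms start_nonneg[of j] by simp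
  then have "furthest i j \<noteq> - 1" using assms by linarith
  then have hi: "furthest i j \<le> hi i j" using assms(1) by (auto elim: furthest_cases[of j i])
  have "l \<le> start (Suc j)" "l' \<le> start (Suc j)" "start j \<le> l"
    using furthest_le[of j i] assms by simp_all
  then show ?thesis using locations_edge[of j l i] locations_edge[of j l' i] assms hi by simp
qed

text \<open>Induction on \<open>i\<close>. Every chord part that contains a predecessor of some
  \<open>l\<close> on edge \<open>j\<close> ends at or before \<open>lo (Suc i) j\<close>. The
  largest such right end is therefore the best predecessor for the whole chord at once.\<close>

lemma reachable_edge:
  assumes "i < k" "j < edges" "start j \<le> l" "l \<le> start (Suc j)"
  shows "l \<in> reachable i \<longleftrightarrow> lo i j \<le> l \<and> l \<le> furthest i j"
  using assms
proof (induction i arbitrary: j l)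
  case 0
  have "0 \<le> l" using 0 start_nonneg[of j] by simp
  then show ?case using 0 locations_edge[of j l 0] by auto
next
  case (Suc i)
  have l0: "0 \<le> l" and ik: "i < k" using Suc.prems start_nonneg[of j] by simp_all
  define m where "m = peak {..lo (Suc i) j} (furthest i) (Suc j)"
  show ?case
  proof
    assume "l \<in> reachable (Suc i)"
    then obtain l' where l: "l \<in> locations (Suc i)" and l': "l' \<in> reachable i" "l' \<le> l"
      "l - l' \<le> gap i" by auto
    have loc: "l' \<in> locations i" using l' reachable_locations by blast
    have lohi: "lo (Suc i) j \<le> l" "l \<le> hi (Suc i) j"
      using l locations_edge Suc.prems by simp_all
    have "0 \<le> l'" "l' \<le> total_time I" using loc by (auto simp: locations_def)
    then obtain j' where j': "j' < edges" "start j' \<le> l'" "l' \<le> start (Suc j')"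
      by (rule edge_exists)
    have up: "l' \<le> furthest i j'" using Suc.IH[OF ik j'] l' by simp
    \<comment> \<open>On a later edge, \<open>l' <= l\<close> would force both to be the same node,
      lying in two disks.\<close>
    have "j' \<le> j"
    proof (rule ccontr)
      assume "\<not> j' \<le> j"
      then have "start (Suc j) \<le> start j'" using j' by (intro start_mono) auto
      then have "l = l'" using Suc.prems j' l' by simp
      then show False using locations_disjoint[OF l, of i] loc Suc.prems by simp
    qed
    have "furthest i j' \<le> lo (Suc i) j"
    proof (rule ccontr)
      assume less: "\<not> furthest i j' \<le> lo (Suc i) j"
      \<comment> \<open>If the right end passed the start of the new chord, this point would belong
        to both chords.\<close>
      let ?x = "max l' (lo (Suc i) j)"
      have "?x \<in> locations i"
        using locations_between[OF j'(1,2) loc, of ?x] up less by simp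
      moreover have "?x \<in> locations (Suc i)"
        using locations_edge[of j ?x "Suc i"] Suc.prems lo_ge[of j "Suc i"] lohi l'
        by (simp add: max_def)
      ultimately show False using locations_disjoint[of ?x i "Suc i"] Suc.prems by simp
    qed
    then have "furthest i j' \<le> m"
      unfolding m_def using \<open>j' \<le> j\<close> by (intro peak_ge) simp_all
    then have "0 \<le> m" "l \<le> m + gap i" using up \<open>0 \<le> l'\<close> l' by simp_all
    then show "lo (Suc i) j \<le> l \<and> l \<le> furthest (Suc i) j"
      using lohi by (auto simp: m_def[symmetric] Let_def)
  next
    assume l: "lo (Suc i) j \<le> l \<and> l \<le> furthest (Suc i) j"
    \<comment> \<open>A negative \<open>m\<close> would make the table entry \<open>-1\<close>,
      which is below \<open>l >= 0\<close>. So \<open>m\<close> is a genuine right end and itself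
      serves as the predecessor.\<close>
    then have "\<not> m < 0" and bounds: "l \<le> hi (Suc i) j" "l \<le> m + gap i"
      using l0 by (auto simp: m_def[symmetric] Let_def split: if_splits)
    then obtain j' where j': "j' < Suc j" "furthest i j' \<le> lo (Suc i) j" "m = furthest i j'"
      unfolding m_def by (cases rule: peak_cases[of "{..lo (Suc i) j}" "furthest i" "Suc j"]) auto
    then have e: "j' < edges" using Suc.prems by simp
    then have "lo i j' \<le> m" using \<open>\<not> m < 0\<close> j' by (auto elim: furthest_cases[of j' i])
    then have "m \<in> reachable i"
      using Suc.IH[OF ik e, of m] lo_ge[OF e, of i] furthest_le[OF e, of i] j' by simp
    moreover have "l \<in> locations (Suc i)" using locations_edge Suc.prems l bounds by simp
    ultimately show "l \<in> reachable (Suc i)" using l j' bounds by (auto intro!: bexI[of _ m])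
  qed
qed

lemma furthest_reachable:
  assumes "i < k" "j < edges" "0 \<le> furthest i j"
  shows "furthest i j \<in> reachable i"
proof -
  have "lo i j \<le> furthest i j" using assms by (auto elim: furthest_cases[of j i])
  then show ?thesis
    using reachable_edge[OF assms(1,2), of "furthest i j"] assms lo_ge[of j i] furthest_le[of j i] by simp
qed

lemma peak_reachable:
  assumes "i < k" "0 \<le> peak A (furthest i) edges"
  shows "peak A (furthest i) edges \<in> reachable i \<inter> A"
  using assms furthest_reachable by (cases rule: peak_cases[of A "furthest i" edges]) auto

text \<open>Starts the backward walk: the bound \<open>total_time I\<close> excludes no entry, so
  one reachable location makes the maximum nonnegative.\<close>

lemma reachable_last:
  assumes "i < k" "l \<in> reachable i"
  shows "0 \<le> peak {..total_time I} (furthest i) edges"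
proof -
  have "0 \<le> l" "l \<le> total_time I" using assms reachable_locations by (auto simp: locations_def)
  then obtain j where j: "j < edges" "start j \<le> l" "l \<le> start (Suc j)" by (rule edge_exists)
  then have "l \<le> furthest i j" using reachable_edge assms by simp
  moreover have "furthest i j \<le> total_time I"
    using furthest_le[of j i] start_mono[of "Suc j" edges] start_edges j by simp
  then have "furthest i j \<le> peak {..total_time I} (furthest i) edges" using j by (intro peak_ge) simp_all
  ultimately show ?thesis using \<open>0 \<le> l\<close> by simp
qed

text \<open>Correctness of the greedy choice. The right end of the part containing a witness
  \<open>l'\<close> cannot pass \<open>l\<close>, or \<open>l\<close> would lie in two disks. Hence
  \<open>l' <= m <= l\<close>, and moving the predecessor from \<open>l'\<close> to \<open>m\<close>
  only shortens the travel time.\<close>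

lemma reachable_predecessor:
  assumes "Suc i < k" "l \<in> reachable (Suc i)" and m: "m = peak {..l} (furthest i) edges"
  shows "m \<in> reachable i" "m \<le> l" "l - m \<le> gap i"
proof -
  obtain l' where loc: "l \<in> locations (Suc i)" and l': "l' \<in> reachable i" "l' \<le> l"
      "l - l' \<le> gap i" using assms(2) by auto
  have loc': "l' \<in> locations i" using l' reachable_locations by blast
  then have "0 \<le> l'" "l' \<le> total_time I" by (auto simp: locations_def)
  then obtain j where j: "j < edges" "start j \<le> l'" "l' \<le> start (Suc j)" by (rule edge_exists)
  then have up: "l' \<le> furthest i j" using reachable_edge assms l' by simp
  have "furthest i j \<le> l"
  proof (rule ccontr)
    assume "\<not> furthest i j \<le> l"
    then have "l \<in> locations i" using locations_between[OF j(1,2) loc' l'(2)] by simp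
    then show False using locations_disjoint[OF loc, of i] assms by simp
  qed
  then have "furthest i j \<le> m" unfolding m using j by (intro peak_ge) simp_all
  then have "l' \<le> m" using up by simp
  then show "l - m \<le> gap i" using l' by simp
  show "m \<in> reachable i" "m \<le> l"
    using peak_reachable[of i "{..l}"] \<open>l' \<le> m\<close> \<open>0 \<le> l'\<close> assms by simp_all
qed

section \<open>Recovering a mapping sequence\<close>

lemma feasible_reachable:
  assumes "feasible I ls" "i < k"
  shows "ls ! i \<in> reachable i"
  using assms(2)
proof (induction i)
  case 0
  then show ?case using assms by (simp add: feasible_def locations_def)
next
  case (Suc i)
  have "ls ! i \<le> ls ! Suc i" "ls ! Suc i - ls ! i \<le> gap i"
    using assms(1) Suc.prems unfolding feasible_def gap_def by (auto dest!: spec[of _ "Suc i"])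
  moreover have "ls ! Suc i \<in> locations (Suc i)"
    using assms(1) Suc.prems by (simp add: feasible_def locations_def)
  ultimately show ?case using Suc by auto
qed

text \<open>The mapping sequence is read off the table backwards. The entries are negative if the last
  row has no reachable location.\<close>

primrec walk_back :: "nat \<Rightarrow> real" where
  "walk_back 0 = total_time I"
| "walk_back (Suc m) = peak {..walk_back m} (furthest (k - Suc m)) edges"

text \<open>The feasible sequence guarantees a reachable location in the last row; from there
  \<open>reachable_predecessor\<close> carries the walk down.\<close>

lemma walk_back_reachable:
  assumes "feasible I ls" "m < k"
  shows "walk_back (Suc m) \<in> reachable (k - Suc m)"
  using assms(2)
proof (induction m)
  case 0
  have "ls ! (k - 1) \<in> reachable (k - 1)" using feasible_reachable assms k_pos by simp
  then have "0 \<le> peak {..total_time I} (furthest (k - 1)) edges"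
    using reachable_last k_pos by simp
  then show ?case using peak_reachable[of "k - 1"] k_pos by simp
next
  case (Suc m)
  have "Suc (k - Suc (Suc m)) = k - Suc m" using Suc.prems by simp
  then show ?case
    using Suc reachable_predecessor(1)[of "k - Suc (Suc m)" "walk_back (Suc m)"] by simp
qed

lemma walk_back_nonneg:
  assumes "feasible I ls"
  shows "0 \<le> walk_back k"
proof -
  have "walk_back k \<in> reachable 0"
    using walk_back_reachable[OF assms, of "k - 1"] k_pos by (simp del: reachable.simps walk_back.simps)
  then show ?thesis by (simp add: locations_def)
qed

text \<open>A nonnegative maximum below a bound forces the bound to be nonnegative. A failed walk
  thus stays negative, and its final entry alone reveals failure.\<close>

lemma walk_back_nonneg_mono:
  assumes "m \<le> m'" "0 \<le> walk_back m'"
  shows "0 \<le> walk_back m"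
  using assms
proof (induction m' rule: dec_induct)
  case (step m')
  then show ?case
    by (cases rule: peak_cases[of "{..walk_back m'}" "furthest (k - Suc m')" edges]) auto
qed

lemma walk_back_feasible:
  assumes nonneg: "0 \<le> walk_back k"
    and xs: "length xs = k" "\<And>i. i < k \<Longrightarrow> xs ! i = walk_back (k - i)"
  shows "feasible I xs"
proof -
  have reach: "xs ! i \<in> reachable i" if "i < k" for i
  proof -
    have "0 \<le> walk_back (Suc (k - Suc i))"
      using walk_back_nonneg_mono[OF _ nonneg] that by (simp del: walk_back.simps)
    then have "walk_back (Suc (k - Suc i)) \<in> reachable i"
      using peak_reachable[of i "{..walk_back (k - Suc i)}"] that by simp
    then show ?thesis using xs(2)[OF that] that by (simp del: walk_back.simps add: Suc_diff_Suc)
  qed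
  have step: "xs ! i \<le> xs ! Suc i \<and> xs ! Suc i - xs ! i \<le> gap i" if "Suc i < k" for i
  proof -
    have "xs ! i = walk_back (Suc (k - Suc i))"
      using xs(2)[of i] that by (simp del: walk_back.simps add: Suc_diff_Suc)
    also have "\<dots> = peak {..xs ! Suc i} (furthest i) edges"
      using xs(2)[of "Suc i"] that by simp
    finally show ?thesis
      using reachable_predecessor[OF that reach[OF that]] by simp
  qed
  show ?thesis
    unfolding feasible_def
  proof (intro conjI allI impI)
    fix i assume "i < k"
    then have "xs ! i \<in> locations i" using reach reachable_locations by blast
    then show "0 \<le> xs ! i" "xs ! i \<le> total_time I" "norm (\<gamma> I (xs ! i) - position I i) \<le> radius I"
      by (auto simp: locations_def)
  next
    fix i assume "1 \<le> i \<and> i < k"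
    then obtain i' where "i = Suc i'" "Suc i' < k" by (cases i) auto
    then show "xs ! (i - 1) \<le> xs ! i" "xs ! i - xs ! (i - 1) \<le> timestamp I i - timestamp I (i - 1)"
      using step[of i'] by (simp_all add: gap_def)
  qed (use xs in simp)
qed

end

section \<open>The program\<close>

text \<open>Index cells: number of nodes, number of measurements, current measurement \<open>i\<close>, current
  edge \<open>j\<close>, and the address of the current table row. The four real cells behind the input hold
  a location (the start of the current edge, then the latest location chosen), the running
  maximum, and the ends of the current chord; the table follows. The entry of the preceding row
  for the same edge is \<open>n - 1\<close> cells back.\<close>

abbreviation reg :: "nat \<Rightarrow> iexp" where "reg q \<equiv> ICell (IConst q)"

definition thrice :: "iexp \<Rightarrow> iexp" where "thrice a = IPlus a (IPlus a a)"

lemma ival_thrice [simp]: "ival (thrice a) s = 3 * ival a s"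
  by (simp add: thrice_def)

text \<open>The input occupies \<open>1 + 2 n + (n - 1) + 3 k = 3 n + 3 k\<close> cells, so these
  addresses lie directly behind it.\<close>

definition scratch :: "nat \<Rightarrow> iexp" where
  "scratch q = IPlus (IPlus (thrice (reg 0)) (thrice (reg 1))) (IConst q)"

definition entry :: iexp where "entry = IPlus (reg 4) (reg 3)"

text \<open>Cell 0 holds the radius, so offsets 1 and 2 give the coordinates of the current node,
  and 3 and 4 those of the next one.\<close>

definition coord :: "nat \<Rightarrow> rexp" where
  "coord q = RCell (IPlus (IConst q) (IPlus (reg 3) (reg 3)))"

definition edge_cost :: rexp where
  "edge_cost = RCell (IPlus (IConst 1) (IPlus (IPlus (reg 0) (reg 0)) (reg 3)))"

definition meas :: "nat \<Rightarrow> rexp" where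
  "meas q = RCell (IPlus (IPlus (thrice (reg 0)) (thrice (reg 2))) (IConst q))"

text \<open>The preceding timestamp is the last cell of the preceding record, one cell before the
  current record.\<close>

definition gap_exp :: rexp where
  "gap_exp = RMinus (meas 2)
     (RCell (IMinus (IPlus (thrice (reg 0)) (thrice (reg 2))) (IConst 1)))"

definition inner_exp :: "rexp \<times> rexp \<Rightarrow> rexp \<times> rexp \<Rightarrow> rexp" where
  "inner_exp v w = RPlus (RTimes (fst v) (fst w)) (RTimes (snd v) (snd w))"

definition edge_exp :: "rexp \<times> rexp" where
  "edge_exp = (RMinus (coord 3) (coord 1), RMinus (coord 4) (coord 2))"

definition offset_exp :: "rexp \<times> rexp" where
  "offset_exp = (RMinus (coord 1) (meas 0), RMinus (coord 2) (meas 1))"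

definition a_exp :: rexp where "a_exp = inner_exp edge_exp edge_exp"
definition b_exp :: rexp where "b_exp = inner_exp offset_exp edge_exp"
definition g_exp :: rexp where
  "g_exp = RMinus (inner_exp offset_exp offset_exp) (RTimes (RCell (IConst 0)) (RCell (IConst 0)))"
definition disc_exp :: rexp where
  "disc_exp = RMinus (RTimes b_exp b_exp) (RTimes a_exp g_exp)"

text \<open>The two cells first hold fractions of the edge; the final assignments turn them into
  travel times from the start of the path.\<close>

definition chord_com :: com where
  "chord_com = Seq
     (Cond (BAnd (RLess (RConst 0) a_exp) (BNot (RLess disc_exp (RConst 0))))
       (Seq (assign_max (scratch 2)
              (RDivide (RMinus (RMinus (RConst 0) b_exp) (RSqrt disc_exp)) a_exp) (RConst 0))
            (assign_min (scratch 3)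
              (RDivide (RPlus (RMinus (RConst 0) b_exp) (RSqrt disc_exp)) a_exp) (RConst 1)))
       (Seq (RAssign (scratch 2) (RConst 0))
            (Cond (BAnd (BNot (RLess (RConst 0) a_exp)) (BNot (RLess (RConst 0) g_exp)))
              (RAssign (scratch 3) (RConst 1))
              (RAssign (scratch 3) (RConst (- 1))))))
     (Seq (RAssign (scratch 2) (RPlus (RCell (scratch 0)) (RTimes edge_cost (RCell (scratch 2)))))
          (RAssign (scratch 3) (RPlus (RCell (scratch 0)) (RTimes edge_cost (RCell (scratch 3))))))"

definition above_exp :: rexp where
  "above_exp = RCell (IMinus (IPlus entry (IConst 1)) (reg 0))"

definition raise_com :: com where
  "raise_com = assign_max (scratch 1) (RCell (scratch 1)) above_exp"

definition clip_com :: com where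
  "clip_com = Cond (RLess (RCell (scratch 1)) (RConst 0)) (RAssign (scratch 3) (RConst (- 1)))
     (assign_min (scratch 3) (RCell (scratch 3)) (RPlus (RCell (scratch 1)) gap_exp))"

text \<open>The preceding row's entry for edge \<open>j\<close> may bound the chord on edge
  \<open>j\<close> only if it does not exceed the left end of that chord. For all later edges it
  certainly lies behind, so it is added again unconditionally after clipping. The first row has no
  predecessor.\<close>

definition advance_com :: com where
  "advance_com = Cond (ILess (IConst 0) (reg 2))
     (Seq (Cond (RLess (RCell (scratch 2)) above_exp) Skip raise_com) (Seq clip_com raise_com))
     Skip"

definition cell_com :: com where
  "cell_com = Seq chord_com (Seq advance_com (Seq
     (Cond (RLess (RCell (scratch 3)) (RCell (scratch 2)))
       (RAssign entry (RConst (- 1))) (RAssign entry (RCell (scratch 3))))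
     (Seq (RAssign (scratch 0) (RPlus (RCell (scratch 0)) edge_cost))
          (IAssign (IConst 3) (IPlus (reg 3) (IConst 1))))))"

definition more_edges :: bexp where
  "more_edges = ILess (IPlus (reg 3) (IConst 1)) (reg 0)"

definition row_init_com :: com where
  "row_init_com = Seq (IAssign (IConst 3) (IConst 0))
     (Seq (RAssign (scratch 0) (RConst 0)) (RAssign (scratch 1) (RConst (- 1))))"

definition row_exit_com :: com where
  "row_exit_com = Seq (IAssign (IConst 4) (IMinus (IPlus (reg 4) (reg 0)) (IConst 1)))
     (IAssign (IConst 2) (IPlus (reg 2) (IConst 1)))"

definition row_com :: com where
  "row_com = Seq row_init_com (Seq (Loop more_edges cell_com) row_exit_com)"

definition pick_com :: com where
  "pick_com = Seq
     (Cond (RLess (RCell (scratch 0)) (RCell entry)) Skip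
       (assign_max (scratch 1) (RCell (scratch 1)) (RCell entry)))
     (IAssign (IConst 3) (IPlus (reg 3) (IConst 1)))"

definition back_init_com :: com where
  "back_init_com = Seq
     (Seq (IAssign (IConst 3) (IConst 0)) (RAssign (scratch 1) (RConst (- 1))))
     (Seq (IAssign (IConst 4) (IMinus (IPlus (reg 4) (IConst 1)) (reg 0)))
          (IAssign (IConst 2) (IMinus (reg 2) (IConst 1))))"

text \<open>The second assignment writes the result for measurement \<open>i\<close> to real cell
  \<open>i\<close>. This overwrites input, which the backward walk no longer reads.\<close>

definition back_exit_com :: com where
  "back_exit_com = Seq (RAssign (scratch 0) (RCell (scratch 1)))
     (RAssign (reg 2) (RCell (scratch 1)))"

definition back_com :: com where
  "back_com = Seq back_init_com (Seq (Loop more_edges pick_com) back_exit_com)"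

definition table_init_com :: com where
  "table_init_com = IAssign (IConst 4) (scratch 4)"

definition report_com :: com where
  "report_com = Cond (RLess (RCell (IConst 0)) (RConst 0))
     (IAssign (IConst 0) (IConst 0)) (IAssign (IConst 0) (IConst 1))"

definition comma :: com where
  "comma = Seq table_init_com (Seq (Loop (ILess (reg 2) (reg 1)) row_com)
     (Seq (Loop (ILess (IConst 0) (reg 2)) back_com) report_com))"

lemma loop_free_com [simp]: "loop_free cell_com" "loop_free row_init_com" "loop_free row_exit_com"
  "loop_free pick_com" "loop_free back_init_com" "loop_free back_exit_com"
  "loop_free table_init_com" "loop_free report_com"
  by (simp_all add: cell_com_def chord_com_def advance_com_def raise_com_def clip_com_def
      row_init_com_def row_exit_com_def
      pick_com_def back_init_com_def back_exit_com_def table_init_com_def report_com_def)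


section \<open>Correctness and running time of the program\<close>

lemma store_rmem_id [simp]: "s\<lparr>rmem := rmem s\<rparr> = s"
  "s\<lparr>imem := g, rmem := rmem s\<rparr> = s\<lparr>imem := g\<rparr>"
  by (cases s; simp)+

section \<open>Layout of the encoded input\<close>

lemma length_concat_map:
  "(\<And>x. x \<in> set xs \<Longrightarrow> length (f x) = q) \<Longrightarrow> length (concat (map f xs)) = q * length xs"
  by (induction xs) auto

lemma nth_concat_map:
  assumes "\<And>x. x \<in> set xs \<Longrightarrow> length (f x) = q" "i < length xs" "c < q"
  shows "concat (map f xs) ! (q * i + c) = f (xs ! i) ! c"
  using assms
proof (induction xs arbitrary: i)
  case (Cons x xs)
  then show ?case
    by (cases i) (auto simp: nth_append add.assoc)
qed simp

context matching
begin

lemma length_encode: "length (encode I) = 3 * n + 3 * k"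
proof -
  have "length (concat (map (\<lambda>(x, y). [x, y]) (nodes I))) = 2 * n"
    unfolding num_nodes_def by (rule length_concat_map) auto
  moreover have "length (concat (map (\<lambda>((x, y), t). [x, y, t]) (measurements I))) = 3 * k"
    unfolding num_meas_def by (rule length_concat_map) auto
  ultimately show ?thesis using n_eq by (simp add: encode_def)
qed

lemma encode_radius: "encode I ! 0 = radius I"
  by (simp add: encode_def)

lemma encode_node:
  assumes "j < n"
  shows "encode I ! Suc (2 * j) = fst (nodes I ! j)"
    and "encode I ! Suc (Suc (2 * j)) = snd (nodes I ! j)"
proof -
  let ?f = "\<lambda>(x, y). [x, y] :: real list"
  have len: "length (concat (map ?f (nodes I))) = 2 * n"
    unfolding num_nodes_def by (rule length_concat_map) auto
  have "concat (map ?f (nodes I)) ! (2 * j + c) = ?f (nodes I ! j) ! c" if "c < 2" for c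
    using assms that unfolding num_nodes_def by (intro nth_concat_map) auto
  from this[of 0] this[of 1]
  show "encode I ! Suc (2 * j) = fst (nodes I ! j)"
    and "encode I ! Suc (Suc (2 * j)) = snd (nodes I ! j)"
    using len assms by (simp_all add: encode_def nth_append split: prod.splits)
qed

lemma encode_cost:
  assumes "j < edges"
  shows "encode I ! Suc (2 * n + j) = costs I ! j"
proof -
  let ?f = "\<lambda>(x, y). [x, y] :: real list"
  have "length (concat (map ?f (nodes I))) = 2 * n"
    unfolding num_nodes_def by (rule length_concat_map) auto
  then show ?thesis using assms by (simp add: encode_def nth_append)
qed

lemma encode_meas:
  assumes "i < k"
  shows "encode I ! (3 * n + 3 * i) = fst (position I i)"
    and "encode I ! Suc (3 * n + 3 * i) = snd (position I i)"
    and "encode I ! Suc (Suc (3 * n + 3 * i)) = timestamp I i"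
proof -
  let ?f = "\<lambda>(x, y). [x, y] :: real list"
  let ?g = "\<lambda>((x, y), t). [x, y, t] :: real list"
  have "length (concat (map ?f (nodes I))) = 2 * n"
    unfolding num_nodes_def by (rule length_concat_map) auto
  \<comment> \<open>Radius, nodes and costs fill \<open>1 + 2 n + (n - 1) = 3 n\<close>
    cells.\<close>
  then have "encode I ! (3 * n + c) = concat (map ?g (measurements I)) ! c" for c
    using n_eq by (simp add: encode_def nth_append nth_Cons')
  moreover have "concat (map ?g (measurements I)) ! (3 * i + c) = ?g (measurements I ! i) ! c"
    if "c < 3" for c
    using assms that unfolding num_meas_def by (intro nth_concat_map) auto
  ultimately have "encode I ! (3 * n + 3 * i + c) = ?g (measurements I ! i) ! c" if "c < 3" for c
    using that by (simp add: add.assoc)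
  from this[of 0] this[of 1] this[of 2]
  show "encode I ! (3 * n + 3 * i) = fst (position I i)"
    and "encode I ! Suc (3 * n + 3 * i) = snd (position I i)"
    and "encode I ! Suc (Suc (3 * n + 3 * i)) = timestamp I i"
    by (simp_all add: position_def timestamp_def numeral_2_eq_2 split: prod.splits)
qed

section \<open>The forward sweep\<close>

definition base :: nat where "base = 3 * n + 3 * k"

definition view :: "nat \<Rightarrow> nat \<Rightarrow> store \<Rightarrow> bool" where
  "view i j s \<longleftrightarrow> imem s 0 = n \<and> imem s 1 = k \<and> imem s 2 = i \<and> imem s 3 = j \<and>
     (\<forall>a < base. rmem s a = encode I ! a)"

lemma view_update [simp]:
  "base \<le> a \<Longrightarrow> view i j (s\<lparr>rmem := f(a := x)\<rparr>) \<longleftrightarrow> view i j (s\<lparr>rmem := f\<rparr>)"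
  by (auto simp: view_def)

lemma ival_scratch [simp]:
  "imem s 0 = n \<Longrightarrow> imem s (Suc 0) = k \<Longrightarrow> ival (scratch q) s = base + q"
  by (simp add: scratch_def base_def)

lemma view_imem:
  assumes "view i j s"
  shows "imem s 0 = n" "imem s (Suc 0) = k" "imem s 2 = i" "imem s 3 = j"
  using assms by (simp_all add: view_def)

lemma view_values:
  assumes "view i j s" "i < k" "j < edges"
  shows "rval a_exp s = coeff_a j" "rval b_exp s = coeff_b i j" "rval g_exp s = coeff_g i j"
    and "rval disc_exp s = coeff_b i j * coeff_b i j - coeff_a j * coeff_g i j"
    and "rval edge_cost s = costs I ! j"
    and "i = Suc i' \<Longrightarrow> rval gap_exp s = gap i'"
proof -
  have cell: "rmem s a = encode I ! a" if "a < base" for a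
    using assms that by (simp add: view_def)
  have j: "Suc j < n" using assms n_eq by simp
  have coord: "rval (coord q) s = encode I ! (q + 2 * j)" if "q \<le> 4" for q
    using that j by (simp add: coord_def view_imem[OF assms(1)] cell base_def mult_2)
  have coords: "rval (coord 1) s = fst (nodes I ! j)" "rval (coord 2) s = snd (nodes I ! j)"
    "rval (coord 3) s = fst (nodes I ! Suc j)" "rval (coord 4) s = snd (nodes I ! Suc j)"
    unfolding coord[OF one_le_numeral] coord[of 2, simplified] coord[of 3, simplified]
      coord[of 4, simplified]
    using j encode_node[of j] encode_node[of "Suc j"] by (simp_all add: eval_nat_numeral)
  have meas: "rval (meas 0) s = fst (position I i)" "rval (meas 1) s = snd (position I i)"
    "rval (meas 2) s = timestamp I i"
    using encode_meas[of i] assms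
    by (simp_all add: meas_def view_imem[OF assms(1)] cell base_def)
  have radius: "rval (RCell (IConst 0)) s = radius I"
    using k_pos by (simp add: cell base_def encode_radius)
  show "rval a_exp s = coeff_a j"
    by (simp add: a_exp_def inner_exp_def edge_exp_def coords[simplified] coeff_a_def dx_def dy_def)
  moreover show "rval b_exp s = coeff_b i j"
    by (simp add: b_exp_def inner_exp_def edge_exp_def offset_exp_def coords[simplified]
        meas[simplified] coeff_b_def dx_def dy_def qx_def qy_def)
  moreover show "rval g_exp s = coeff_g i j"
    using radius by (simp add: g_exp_def inner_exp_def offset_exp_def coords[simplified]
        meas[simplified] coeff_g_def qx_def qy_def)
  ultimately show "rval disc_exp s = coeff_b i j * coeff_b i j - coeff_a j * coeff_g i j"
    by (simp add: disc_exp_def)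
  show "rval edge_cost s = costs I ! j"
    using encode_cost[of j, unfolded mult_2] assms n_eq
    by (simp add: edge_cost_def view_imem[OF assms(1)] cell base_def)
  show "rval gap_exp s = gap i'" if "i = Suc i'"
  proof -
    \<comment> \<open>This is the cell of the timestamp of measurement \<open>i'\<close>.\<close>
    have "3 * n + 3 * i - 1 = Suc (Suc (3 * n + 3 * i'))" using that by simp
    then show ?thesis
      using encode_meas(3)[of i'] assms that
      by (simp add: gap_exp_def meas view_imem[OF assms(1)] cell base_def gap_def)
  qed
qed

lemma effect_chord:
  assumes v: "view i j s" and ij: "i < k" "j < edges" and pos: "rmem s base = start j"
  shows "effect chord_com s = s\<lparr>rmem := (rmem s)(base + 2 := lo i j, base + 3 := hi i j)\<rparr>"
proof -
  define ends where "ends = Cond (BAnd (RLess (RConst 0) a_exp) (BNot (RLess disc_exp (RConst 0))))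
       (Seq (assign_max (scratch 2)
              (RDivide (RMinus (RMinus (RConst 0) b_exp) (RSqrt disc_exp)) a_exp) (RConst 0))
            (assign_min (scratch 3)
              (RDivide (RPlus (RMinus (RConst 0) b_exp) (RSqrt disc_exp)) a_exp) (RConst 1)))
       (Seq (RAssign (scratch 2) (RConst 0))
            (Cond (BAnd (BNot (RLess (RConst 0) a_exp)) (BNot (RLess (RConst 0) g_exp)))
              (RAssign (scratch 3) (RConst 1))
              (RAssign (scratch 3) (RConst (- 1)))))"
  note vals = view_values[OF _ ij] view_imem[OF v]
  have ends: "effect ends s = s\<lparr>rmem := (rmem s)
      (base + 2 := chord_lo (coeff_a j) (coeff_b i j) (coeff_g i j),
       base + 3 := chord_hi (coeff_a j) (coeff_b i j) (coeff_g i j))\<rparr>"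
    by (auto simp: ends_def vals v chord_lo_def chord_hi_def not_less)
  show ?thesis
    unfolding chord_com_def ends_def[symmetric]
    by (simp add: ends vals v pos lo_def hi_def fun_upd_twist)
qed

text \<open>Entries for edges before \<open>j\<close> end by \<open>start j <= lo i' j\<close>, so
  the bound can only exclude entry \<open>j\<close> itself. One unrestricted running maximum
  therefore suffices, and each table entry takes constant time.\<close>

lemma peak_running:
  assumes "j < edges"
  shows "peak {..lo i' j} (furthest i) (Suc j) =
    (if furthest i j \<le> lo i' j then max (peak UNIV (furthest i) j) (furthest i j)
     else peak UNIV (furthest i) j)"
proof -
  have "furthest i m \<le> lo i' j" if "m < j" for m
    using that assms furthest_le[of m i] start_mono[of "Suc m" j] lo_ge[of j i'] by simp
  then have "peak {..lo i' j} (furthest i) j = peak UNIV (furthest i) j"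
    by (intro peak_cong) simp
  then show ?thesis by (simp add: peak_Suc)
qed

definition table :: "nat \<Rightarrow> store \<Rightarrow> bool" where
  "table m s \<longleftrightarrow> (\<forall>y < m. rmem s (base + 4 + y) = furthest (y div edges) (y mod edges))"

lemma table_entry:
  assumes "table m s" "i * edges + j < m" "j < edges"
  shows "rmem s (base + 4 + (i * edges + j)) = furthest i j"
  using assms edges_pos by (simp add: table_def)

definition cell_inv :: "nat \<Rightarrow> nat \<Rightarrow> store \<Rightarrow> bool" where
  "cell_inv i j s \<longleftrightarrow> view i j s \<and> imem s 4 = base + 4 + i * edges \<and> rmem s base = start j \<and>
     (\<forall>i'. i = Suc i' \<longrightarrow> rmem s (Suc base) = peak UNIV (furthest i') j) \<and>
     table (i * edges + j) s"

text \<open>The chord cells stay abstract, so that \<open>cell_step\<close> can treat the first row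
  and the later rows alike.\<close>

lemma advance:
  assumes inv: "cell_inv i j s" and ij: "i < k" "j < edges"
  obtains f where "effect advance_com (effect chord_com s) = s\<lparr>rmem := f\<rparr>"
    "\<And>a. a \<le> base \<or> base + 3 < a \<Longrightarrow> f a = rmem s a"
    "\<And>i'. i = Suc i' \<Longrightarrow> f (Suc base) = peak UNIV (furthest i') (Suc j)"
    "furthest i j = (if f (base + 3) < f (base + 2) then - 1 else f (base + 3))"
proof -
  have v: "view i j s" and row: "imem s 4 = base + 4 + i * edges" and pos: "rmem s base = start j"
    using inv by (auto simp: cell_inv_def)
  note chord = effect_chord[OF v ij pos]
  show ?thesis
  proof (cases i)
    case 0
    then show ?thesis
      by (intro that[of "(rmem s)(base + 2 := lo i j, base + 3 := hi i j)"])
        (auto simp: chord advance_com_def view_imem[OF v])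
  next
    case (Suc i')
    let ?u = "furthest i' j" and ?m = "peak UNIV (furthest i') j"
    let ?m' = "peak {..lo i j} (furthest i') (Suc j)"
    have max: "rmem s (Suc base) = ?m" using inv Suc by (simp add: cell_inv_def)
    \<comment> \<open>A row has \<open>edges = n - 1\<close> cells, so this is the same edge one row
      back.\<close>
    have "imem s 4 + imem s 3 + 1 - imem s 0 = base + 4 + (i' * edges + j)"
      using row n_eq Suc by (simp add: view_imem[OF v])
    moreover have "rmem s (base + 4 + (i' * edges + j)) = ?u"
      using inv Suc ij edges_pos by (intro table_entry[of "i * edges + j"]) (auto simp: cell_inv_def)
    ultimately have above: "rval above_exp (s\<lparr>rmem := f\<rparr>) = ?u"
      if "\<And>a. base + 3 < a \<Longrightarrow> f a = rmem s a" for f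
      using that by (simp add: above_exp_def entry_def)
    let ?g = "(rmem s)(base + 2 := lo i j, base + 3 := hi i j)"
    let ?h = "if ?m' < 0 then - 1 else min (hi i j) (?m' + gap i')"
    have m': "?m' = (if ?u \<le> lo i j then max ?m ?u else ?m)"
      by (rule peak_running[OF ij(2)])
    have bound: "effect (Cond (RLess (RCell (scratch 2)) above_exp) Skip raise_com) (s\<lparr>rmem := ?g\<rparr>) =
        s\<lparr>rmem := ?g(base + 1 := ?m')\<rparr>"
      unfolding m' by (simp add: raise_com_def above view_imem[OF v] max fun_upd_idem)
    have clip: "effect clip_com (s\<lparr>rmem := ?g(base + 1 := ?m')\<rparr>) =
        s\<lparr>rmem := ?g(base + 1 := ?m', base + 3 := ?h)\<rparr>"
      by (simp add: clip_com_def view_imem[OF v] view_values(6)[OF _ ij Suc] v)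
    \<comment> \<open>Taking the maximum with \<open>?u\<close> a second time is harmless if it was
      already included.\<close>
    have raise: "effect raise_com (s\<lparr>rmem := ?g(base + 1 := ?m', base + 3 := ?h)\<rparr>) =
        s\<lparr>rmem := ?g(base + 1 := ?m', base + 3 := ?h, base + 1 := peak UNIV (furthest i') (Suc j))\<rparr>"
      unfolding m' by (simp add: raise_com_def above view_imem[OF v] peak_Suc)
    have positive: "bval (ILess (IConst 0) (reg 2)) (s\<lparr>rmem := ?g\<rparr>)"
      using Suc by (simp add: view_imem[OF v])
    show ?thesis
    proof (rule that)
      show "effect advance_com (effect chord_com s) = s\<lparr>rmem := ?g(base + 1 := ?m',
          base + 3 := ?h, base + 1 := peak UNIV (furthest i') (Suc j))\<rparr>"
        unfolding advance_com_def chord effect.simps(5)[of "ILess (IConst 0) (reg 2)"]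
        by (simp only: effect.simps(4) bound clip raise positive if_True)
    qed (use Suc in \<open>auto simp: Let_def\<close>)
  qed
qed

lemma cell_step:
  assumes inv: "cell_inv i j s" and ij: "i < k" "j < edges"
  shows "cell_inv i (Suc j) (effect cell_com s)"
proof -
  have v: "view i j s" and row: "imem s 4 = base + 4 + i * edges" and pos: "rmem s base = start j"
    and tab: "table (i * edges + j) s"
    using inv by (auto simp: cell_inv_def)
  obtain f where f: "effect advance_com (effect chord_com s) = s\<lparr>rmem := f\<rparr>"
    "\<And>a. a \<le> base \<or> base + 3 < a \<Longrightarrow> f a = rmem s a"
    "\<And>i'. i = Suc i' \<Longrightarrow> f (Suc base) = peak UNIV (furthest i') (Suc j)"
    "furthest i j = (if f (base + 3) < f (base + 2) then - 1 else f (base + 3))"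
    using advance[OF assms] by blast
  have v': "view i j (s\<lparr>rmem := f\<rparr>)" using v f(2) by (simp add: view_def)
  have "ival entry (s\<lparr>rmem := f\<rparr>) = base + 4 + (i * edges + j)"
    using row by (simp add: entry_def view_imem[OF v])
  then have effect: "effect cell_com s = s\<lparr>imem := (imem s)(3 := Suc j),
      rmem := f(base + 4 + (i * edges + j) := furthest i j, base := start (Suc j))\<rparr>"
    using f(4) f(2)[of base] pos ij
    by (simp add: cell_com_def f(1) view_imem[OF v] view_values(5)[OF _ ij] v' start_Suc)
  have entries: "f (base + 4 + y) = rmem s (base + 4 + y)" for y
    using f(2) by simp
  have "table (Suc (i * edges + j)) (effect cell_com s)"
    using tab entries ij edges_pos by (auto simp: table_def effect less_Suc_eq)
  moreover have "view i (Suc j) (effect cell_com s)"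
    using v f(2) by (auto simp: view_def effect)
  ultimately show ?thesis
    using row f(3) by (simp add: cell_inv_def effect)
qed

text \<open>After a row, the cell for the start of the current edge has advanced to the end of the
  path. This value is the initial bound \<open>walk_back 0\<close> of the backward walk.\<close>

definition row_inv :: "nat \<Rightarrow> store \<Rightarrow> bool" where
  "row_inv i s \<longleftrightarrow> (\<exists>j. view i j s) \<and> imem s 4 = base + 4 + i * edges \<and> table (i * edges) s \<and>
     (0 < i \<longrightarrow> rmem s base = total_time I)"

lemma row_step:
  assumes "row_inv i s" "i < k"
  shows "runs row_com s (duration row_init_com + (n * (1 + bcost more_edges + duration cell_com)
    + duration row_exit_com)) (row_inv (Suc i))"
  unfolding row_com_def
proof (intro runs_Seq)
  obtain j where v: "view i j s" using assms by (auto simp: row_inv_def)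
  have "effect row_init_com s = s\<lparr>imem := (imem s)(3 := 0),
      rmem := (rmem s)(base := 0, Suc base := - 1)\<rparr>"
    by (simp add: row_init_com_def view_imem[OF v])
  then have "cell_inv i 0 (effect row_init_com s)"
    using v assms by (auto simp: cell_inv_def row_inv_def view_def table_def)
  then show "runs row_init_com s (duration row_init_com) (cell_inv i 0)"
    by (intro runs_loop_free) simp_all
next
  fix s' assume "cell_inv i 0 s'"
  then show "runs (Loop more_edges cell_com) s' (n * (1 + bcost more_edges + duration cell_com))
    (cell_inv i edges)"
    \<comment> \<open>With \<open>n = Suc edges\<close>, the factor \<open>n\<close> covers
      \<open>edges\<close> rounds and the final failing test.\<close>
    unfolding n_eq
  proof (intro runs_Loop)
    fix j s' assume j: "j < edges" and inv: "cell_inv i j s'"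
    then have "bval more_edges s'"
      using n_eq by (simp add: more_edges_def cell_inv_def view_def)
    then show "bval more_edges s' \<and> runs cell_com s' (duration cell_com) (cell_inv i (Suc j))"
      using cell_step[OF inv assms(2) j] by (simp add: runs_loop_free)
  next
    fix s' assume "cell_inv i edges s'"
    then show "\<not> bval more_edges s'"
      using n_eq by (simp add: more_edges_def cell_inv_def view_def)
  qed
next
  fix s' assume inv: "cell_inv i edges s'"
  then have v: "view i edges s'" by (simp add: cell_inv_def)
  have "imem s' 4 + n - 1 = base + 4 + Suc i * edges"
    using inv n_eq by (simp add: cell_inv_def)
  then have "effect row_exit_com s' =
      s'\<lparr>imem := (imem s')(4 := base + 4 + Suc i * edges, 2 := Suc i)\<rparr>"
    by (simp add: row_exit_com_def view_imem[OF v])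
  then have "row_inv (Suc i) (effect row_exit_com s')"
    using inv v by (auto simp: row_inv_def cell_inv_def view_def table_def start_edges add.commute)
  then show "runs row_exit_com s' (duration row_exit_com) (row_inv (Suc i))"
    by (intro runs_loop_free) simp_all
qed

section \<open>The backward walk\<close>

definition pick_inv :: "nat \<Rightarrow> nat \<Rightarrow> store \<Rightarrow> bool" where
  "pick_inv m j s \<longleftrightarrow> imem s 0 = n \<and> imem s 1 = k \<and> imem s 2 = k - Suc m \<and> imem s 3 = j \<and>
     imem s 4 = base + 4 + (k - Suc m) * edges \<and> table (k * edges) s \<and>
     rmem s base = walk_back m \<and>
     rmem s (Suc base) = peak {..walk_back m} (furthest (k - Suc m)) j \<and>
     (\<forall>i. k - m \<le> i \<and> i < k \<longrightarrow> rmem s i = walk_back (k - i))"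

text \<open>In contrast to \<open>view\<close>, nothing is claimed about the input cells: results
  overwrite them from cell \<open>k - 1\<close> downwards.\<close>

definition back_inv :: "nat \<Rightarrow> store \<Rightarrow> bool" where
  "back_inv m s \<longleftrightarrow> imem s 0 = n \<and> imem s 1 = k \<and> imem s 2 = k - m \<and>
     imem s 4 = base + 4 + (k - m) * edges \<and> table (k * edges) s \<and>
     rmem s base = walk_back m \<and>
     (\<forall>i. k - m \<le> i \<and> i < k \<longrightarrow> rmem s i = walk_back (k - i))"

lemma pick_step:
  assumes inv: "pick_inv m j s" and mj: "m < k" "j < edges"
  shows "pick_inv m (Suc j) (effect pick_com s)"
proof -
  let ?i = "k - Suc m"
  have entry: "ival entry s = base + 4 + (?i * edges + j)"
    using inv by (simp add: entry_def pick_inv_def)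
  have "?i * edges + j < Suc ?i * edges" using mj by simp
  also have "\<dots> \<le> k * edges" using mj by (intro mult_le_mono) simp_all
  finally have "rmem s (base + 4 + (?i * edges + j)) = furthest ?i j"
    using inv mj by (intro table_entry[of "k * edges"]) (simp_all add: pick_inv_def)
  then have "effect pick_com s = s\<lparr>imem := (imem s)(3 := Suc j),
      rmem := (rmem s)(Suc base := peak {..walk_back m} (furthest ?i) (Suc j))\<rparr>"
    using inv by (auto simp: pick_com_def entry pick_inv_def peak_Suc fun_upd_idem)
  moreover have "k \<le> base" by (simp add: base_def)
  ultimately show ?thesis using inv by (auto simp: pick_inv_def table_def)
qed

lemma back_step:
  assumes inv: "back_inv m s" and m: "m < k"
  shows "runs back_com s (duration back_init_com + (n * (1 + bcost more_edges + duration pick_com)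
    + duration back_exit_com)) (back_inv (Suc m))"
  unfolding back_com_def
proof (intro runs_Seq)
  have "k - m = Suc (k - Suc m)" using m by simp
  then have "imem s 4 + 1 - n = base + 4 + (k - Suc m) * edges"
    using inv n_eq by (simp add: back_inv_def)
  then have "effect back_init_com s = s\<lparr>imem := (imem s)(3 := 0,
      4 := base + 4 + (k - Suc m) * edges, 2 := k - Suc m), rmem := (rmem s)(Suc base := - 1)\<rparr>"
    using inv by (simp add: back_init_com_def back_inv_def)
  moreover have "k \<le> base" by (simp add: base_def)
  ultimately have "pick_inv m 0 (effect back_init_com s)"
    using inv by (auto simp: pick_inv_def back_inv_def table_def)
  then show "runs back_init_com s (duration back_init_com) (pick_inv m 0)"
    by (intro runs_loop_free) simp_all
next
  fix s' assume "pick_inv m 0 s'"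
  then show "runs (Loop more_edges pick_com) s' (n * (1 + bcost more_edges + duration pick_com))
    (pick_inv m edges)"
    unfolding n_eq
  proof (intro runs_Loop)
    fix j s' assume j: "j < edges" and inv: "pick_inv m j s'"
    then have "bval more_edges s'"
      using n_eq by (simp add: more_edges_def pick_inv_def)
    then show "bval more_edges s' \<and> runs pick_com s' (duration pick_com) (pick_inv m (Suc j))"
      using pick_step[OF inv m j] by (simp add: runs_loop_free)
  next
    fix s' assume "pick_inv m edges s'"
    then show "\<not> bval more_edges s'"
      using n_eq by (simp add: more_edges_def pick_inv_def)
  qed
next
  fix s' assume inv: "pick_inv m edges s'"
  then have "effect back_exit_com s' = s'\<lparr>rmem := (rmem s')
      (base := walk_back (Suc m), k - Suc m := walk_back (Suc m))\<rparr>"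
    by (simp add: back_exit_com_def pick_inv_def)
  \<comment> \<open>The output cells lie below \<open>base\<close>, so writing to them leaves the
    scratch cells and the table intact.\<close>
  moreover have "k \<le> base" "k - (k - Suc m) = Suc m" using m by (simp_all add: base_def)
  ultimately have "back_inv (Suc m) (effect back_exit_com s')"
    using inv k_pos by (auto simp: back_inv_def pick_inv_def table_def simp del: walk_back.simps)
  then show "runs back_exit_com s' (duration back_exit_com) (back_inv (Suc m))"
    by (intro runs_loop_free) simp_all
qed

text \<open>Real cell 0 holds the last value of the walk, the location for measurement 0. It is
  nonnegative exactly when a feasible sequence exists.\<close>

lemma report:
  assumes inv: "back_inv k s"
  shows "correct_output I (effect report_com s)"
proof -
  let ?xs = "map (rmem (effect report_com s)) [0..<k]"
  have "rmem (effect report_com s) = rmem s"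
    by (simp add: report_com_def)
  then have "?xs ! i = walk_back (k - i)" if "i < k" for i
    using inv that by (simp add: back_inv_def)
  then have "0 \<le> walk_back k \<Longrightarrow> feasible I ?xs"
    by (intro walk_back_feasible) simp_all
  moreover have "rmem s 0 = walk_back k" using inv k_pos by (simp add: back_inv_def)
  ultimately show ?thesis
    using walk_back_nonneg by (auto simp: correct_output_def report_com_def)
qed

end

section \<open>The total running time\<close>

definition row_time :: nat where
  "row_time = duration row_init_com + (1 + bcost more_edges + duration cell_com) +
     duration row_exit_com + duration back_init_com + (1 + bcost more_edges + duration pick_com) +
     duration back_exit_com + (1 + bcost (ILess (reg 2) (reg 1))) +
     (1 + bcost (ILess (IConst 0) (reg 2)))"

definition comma_time :: nat where
  "comma_time = duration table_init_com + duration report_com + 2 * row_time"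

context matching
begin

lemma comma_runs: "runs comma (input_store I) (comma_time * (k * n)) (correct_output I)"
proof -
  let ?row = "duration row_init_com + (n * (1 + bcost more_edges + duration cell_com)
    + duration row_exit_com)"
  let ?back = "duration back_init_com + (n * (1 + bcost more_edges + duration pick_com)
    + duration back_exit_com)"
  let ?t1 = "Suc k * (1 + bcost (ILess (reg 2) (reg 1)) + ?row)"
  let ?t2 = "Suc k * (1 + bcost (ILess (IConst 0) (reg 2)) + ?back)"
  have "runs comma (input_store I)
     (duration table_init_com + (?t1 + (?t2 + duration report_com))) (correct_output I)"
    unfolding comma_def
  proof (intro runs_Seq)
    have "effect table_init_com (input_store I) =
        (input_store I)\<lparr>imem := (imem (input_store I))(4 := base + 4)\<rparr>"
      by (simp add: table_init_com_def input_store_def)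
    then have "row_inv 0 (effect table_init_com (input_store I))"
      by (auto simp: row_inv_def view_def table_def input_store_def length_encode base_def)
    then show "runs table_init_com (input_store I) (duration table_init_com) (row_inv 0)"
      by (intro runs_loop_free) simp_all
  next
    fix s assume "row_inv 0 s"
    then show "runs (Loop (ILess (reg 2) (reg 1)) row_com) s ?t1 (row_inv k)"
      by (intro runs_Loop conjI row_step) (auto simp: row_inv_def view_imem)
  next
    fix s assume "row_inv k s"
    \<comment> \<open>Positivity of \<open>k\<close> makes the stored total time available; the
      condition on results is vacuous at this stage.\<close>
    then have "back_inv 0 s"
      using k_pos by (auto simp: row_inv_def back_inv_def view_def)
    then show "runs (Loop (ILess (IConst 0) (reg 2)) back_com) s ?t2 (back_inv k)"
      by (intro runs_Loop conjI back_step) (auto simp: back_inv_def)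
  next
    fix s assume "back_inv k s"
    then show "runs report_com s (duration report_com) (correct_output I)"
      by (intro runs_loop_free report) simp_all
  qed
  moreover have "duration table_init_com + (?t1 + (?t2 + duration report_com)) \<le>
      comma_time * (k * n)"
  proof -
    have n: "1 \<le> n" and k: "1 \<le> k" using n_eq k_pos by simp_all
    \<comment> \<open>Costs that arise once per row are charged once per node.\<close>
    have le: "a \<le> n * a" for a using n by simp
    have "1 + bcost (ILess (reg 2) (reg 1)) + ?row +
        (1 + bcost (ILess (IConst 0) (reg 2)) + ?back) \<le> n * row_time"
      using le[of "duration row_init_com"] le[of "duration row_exit_com"]
        le[of "duration back_init_com"] le[of "duration back_exit_com"] le[of 1]
        le[of "bcost (ILess (reg 2) (reg 1))"] le[of "bcost (ILess (IConst 0) (reg 2))"]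
      unfolding row_time_def distrib_left by linarith
    \<comment> \<open>\<open>Suc k <= 2 * k\<close> produces the factor 2 in
      \<open>comma_time\<close>.\<close>
    then have "Suc k * (1 + bcost (ILess (reg 2) (reg 1)) + ?row +
        (1 + bcost (ILess (IConst 0) (reg 2)) + ?back)) \<le> (2 * k) * (n * row_time)"
      using k by (intro mult_le_mono) simp_all
    then have "?t1 + ?t2 \<le> 2 * row_time * (k * n)"
      by (simp only: distrib_left mult.assoc mult.left_commute mult.commute)
    moreover have "duration table_init_com + duration report_com \<le>
        (duration table_init_com + duration report_com) * (k * n)"
      using n k by simp
    ultimately show ?thesis
      unfolding comma_time_def distrib_right by linarith
  qed
  ultimately show ?thesis by (rule runs_mono)
qed

end

theorem mainTheorem3:
  shows "\<exists>(comma :: com) (C :: real). \<forall>I. valid_instance I \<and> disjoint_disks I \<longrightarrow>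
    (\<exists>time s. exec comma (input_store I) time s \<and> correct_output I s \<and>
      real time \<le> C * (real (num_meas I) * real (num_nodes I) * log 2 (real (num_nodes I))))"
proof (intro exI[of _ comma] exI[of _ "real comma_time"] allI impI)
  fix I assume I: "valid_instance I \<and> disjoint_disks I"
  then interpret matching I by unfold_locales auto
  obtain time s where run: "exec comma (input_store I) time s" "correct_output I s"
    and time: "time \<le> comma_time * (k * n)"
    using comma_runs by (auto simp: runs_def)
  \<comment> \<open>At least two nodes make the logarithm at least 1, so the bound linear in
    \<open>k n\<close> implies the claimed one.\<close>
  have "2 \<le> n" using I by (simp add: valid_instance_def)
  then have "1 \<le> log 2 n" by (simp add: le_log_iff)
  then have "real k * real n * 1 \<le> real k * real n * log 2 n" by (intro mult_left_mono) simp_all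
  moreover have "real time \<le> real comma_time * (real k * real n)"
    using time by (metis of_nat_le_iff of_nat_mult)
  ultimately have "real time \<le> comma_time * (real k * real n * log 2 n)"
    by (smt (verit) mult_left_mono of_nat_0_le_iff)
  then show "\<exists>time s. exec comma (input_store I) time s \<and> correct_output I s \<and>
      real time \<le> comma_time * (real k * real n * log 2 n)"
    using run by blast
qed

end
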